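(* Let $f:\mathbb{R}^n\to\mathbb{R}$ be twice continuously differentiable with a non-empty set of global minimizers, and let $\mathcal{X}=\{x\in\mathbb{R}^n:\nabla f(x)=0,\ \nabla^2 f(x)\succeq 0\}$. Let $x^0\in\mathbb{R}^n$, and suppose that there are a closed convex set $\mathcal{F}\subset\mathbb{R}^n$ with $\mathcal{L}(f(x^0))\subset\operatorname{int}(\mathcal{F})$ and a constant $L>0$ such that $\|\nabla^2 f(x)-\nabla^2 f(y)\|\le L\|x-y\|$ for all $x,y\in\mathcal{F}$. Suppose that there exist scalars $\kappa,\rho>0$ such that $$\operatorname{dist}(x,\mathcal{X})\le\kappa\|\nabla f(x)\|\quad\text{for all } x\in\mathbb{R}^n \text{ with } \operatorname{dist}(x,\mathcal{X})\le\rho.$$ Let $\{x^k\}_{k\ge 0}$ be a sequence of iterates generated by the cubic regularization (CR) method from the initial point $x^0$. If $\mathcal{L}(f(x^k))$ is bounded for some $k\ge 0$, then the whole sequence $\{x^k\}_{k\ge 0}$ converges at least Q-quadratically to a point $x^*\in\mathcal{X}$.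
   Context: $\|\cdot\|$ is the Euclidean norm for vectors and the operator norm for matrices; $\operatorname{dist}(x,C)$ is the Euclidean distance from $x$ to the closed set $C$. For $x\in\mathbb{R}^n$, $\mathcal{L}(f(x))=\{y\in\mathbb{R}^n: f(y)\le f(x)\}$. Cubic model: for $\sigma>0$ and $x,p\in\mathbb{R}^n$, $$f_\sigma(p;x)=f(x)+\nabla f(x)^T(p-x)+\tfrac12(p-x)^T\nabla^2 f(x)(p-x)+\tfrac{\sigma}{6}\|p-x\|^3,$$ $\bar f_\sigma(x)=\min_{p\in\mathbb{R}^n}f_\sigma(p;x)$, and $p_\sigma(x)$ denotes a global minimizer of $f_\sigma(\cdot\,;x)$ over $\mathbb{R}^n$. CR method: given an initial point $x^0$ and a scalar $\bar\sigma\in(0,L]$ (with $L$ the Lipschitz constant of $\nabla^2 f$ on $\mathcal{F}$), for $k=0,1,2,\dots$ find $\sigma_k\in[\bar\sigma,2L]$ such that $f(p_{\sigma_k}(x^k))\le\bar f_{\sigma_k}(x^k)$, and set $x^{k+1}=p_{\sigma_k}(x^k)$. A sequence $\{w^k\}$ converges (at least) Q-quadratically to $w^\infty$ if $w^k\to w^\infty$ and there exists $M>0$ such that $\|w^{k+1}-w^\infty\|\le M\|w^k-w^\infty\|^2$ for all sufficiently large $k$. *)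

theory Defs
  imports "HOL-Analysis.Analysis"
begin

definition grad :: "(real^'n \<Rightarrow> real) \<Rightarrow> real^'n \<Rightarrow> real^'n" where
  "grad f x = (THE D. GDERIV f x :> D)"

definition hess :: "(real^'n \<Rightarrow> real) \<Rightarrow> real^'n \<Rightarrow> real^'n^'n" where
  "hess f x = matrix (frechet_derivative (grad f) (at x))"

definition twice_cont_diff :: "(real^'n \<Rightarrow> real) \<Rightarrow> bool" where
  "twice_cont_diff f \<longleftrightarrow>
     (\<forall>x. f differentiable (at x)) \<and>
     (\<forall>x. grad f differentiable (at x)) \<and>
     continuous_on UNIV (hess f)"

text \<open>The description operator in \<^const>\<open>grad\<close> is well defined wherever \<open>f\<close> is differentiable,
  and \<^const>\<open>hess\<close> is then the derivative of \<^const>\<open>grad\<close> as a matrix.\<close>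

lemma GDERIV_grad:
  fixes f :: "real^'n \<Rightarrow> real"
  assumes "f differentiable (at x)"
  shows "GDERIV f x :> grad f x"
proof -
  obtain f' where f': "(f has_derivative f') (at x)"
    using assms unfolding differentiable_def by blast
  then have lin: "linear f'"
    by (rule has_derivative_linear)
  define D where "D = adjoint f' 1"
  have "f' h = h \<bullet> D" for h
    using adjoint_works[OF lin, of h 1] by (simp add: D_def)
  then have D: "GDERIV f x :> D"
    using f' by (simp add: gderiv_def flip: fun_eq_iff) (metis (no_types, lifting) ext)
  moreover have "E = D" if "GDERIV f x :> E" for E
  proof -
    have "(\<lambda>h. h \<bullet> E) = (\<lambda>h. h \<bullet> D)"
      using that D unfolding gderiv_def by (rule has_derivative_unique)
    then show ?thesis
      by (metis vector_eq_ldot)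
  qed
  ultimately show ?thesis
    unfolding grad_def by (rule theI)
qed

lemma has_derivative_hess:
  fixes f :: "real^'n \<Rightarrow> real"
  assumes "grad f differentiable (at x)"
  shows "(grad f has_derivative (\<lambda>h. hess f x *v h)) (at x)"
  using assms frechet_derivative_works[of "grad f" "at x"]
    linear_frechet_derivative[OF assms]
  by (simp add: hess_def matrix_works)

text \<open>This is only applied to Hessians of twice continuously differentiable functions; these
  are symmetric, so symmetry is not part of the definition.\<close>

definition psd :: "real^'n^'n \<Rightarrow> bool" where
  "psd A \<longleftrightarrow> (\<forall>v. 0 \<le> v \<bullet> (A *v v))"

definition second_order_points :: "(real^'n \<Rightarrow> real) \<Rightarrow> (real^'n) set" where
  "second_order_points f = {x. grad f x = 0 \<and> psd (hess f x)}"

definition sublevel :: "('a \<Rightarrow> real) \<Rightarrow> real \<Rightarrow> 'a set" where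
  "sublevel f c = {y. f y \<le> c}"

definition cubic_model :: "(real^'n \<Rightarrow> real) \<Rightarrow> real \<Rightarrow> real^'n \<Rightarrow> real^'n \<Rightarrow> real" where
  "cubic_model f \<sigma> x p =
     f x + grad f x \<bullet> (p - x) + 1/2 * ((p - x) \<bullet> (hess f x *v (p - x)))
       + \<sigma> / 6 * norm (p - x) ^ 3"

text \<open>For \<open>\<sigma> > 0\<close> the cubic model is continuous and coercive in \<open>p\<close>, so the infimum is a minimum.\<close>

definition cubic_model_min :: "(real^'n \<Rightarrow> real) \<Rightarrow> real \<Rightarrow> real^'n \<Rightarrow> real" where
  "cubic_model_min f \<sigma> x = (INF p. cubic_model f \<sigma> x p)"

text \<open>\<open>cr_iterates f L \<sigma>bar x0 x\<close>: the sequence \<open>x\<close> is a possible run of the cubic regularization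
  method started at \<open>x0\<close>. The global minimizer of the model need not be unique; the same choice
  is used in the acceptance test for \<open>\<sigma> k\<close> and as the next iterate.\<close>

definition cr_iterates ::
    "(real^'n \<Rightarrow> real) \<Rightarrow> real \<Rightarrow> real \<Rightarrow> real^'n \<Rightarrow> (nat \<Rightarrow> real^'n) \<Rightarrow> bool" where
  "cr_iterates f L \<sigma>bar x0 x \<longleftrightarrow>
     x 0 = x0 \<and>
     (\<exists>\<sigma> :: nat \<Rightarrow> real. \<forall>k.
        \<sigma> k \<in> {\<sigma>bar..2 * L} \<and>
        is_arg_min (cubic_model f (\<sigma> k) (x k)) (\<lambda>_. True) (x (Suc k)) \<and>
        f (x (Suc k)) \<le> cubic_model_min f (\<sigma> k) (x k))"

definition converges_Q_quadratically ::
    "(nat \<Rightarrow> 'a::real_normed_vector) \<Rightarrow> 'a \<Rightarrow> bool" where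
  "converges_Q_quadratically w l \<longleftrightarrow>
     w \<longlonglongrightarrow> l \<and>
     (\<exists>M>0. \<forall>\<^sub>F k in sequentially. norm (w (Suc k) - l) \<le> M * norm (w k - l) ^ 2)"

end

theory Submission
  imports Defs
begin

text \<open>
  Write \<open>X\<close> for the set of second-order points, \<open>d\<^sub>k\<close> for the distance of \<open>x\<^sub>k\<close> to \<open>X\<close>, and
  \<open>s\<^sub>k = x\<^sub>k\<^sub>+\<^sub>1 - x\<^sub>k\<close>. Convergence rests on three estimates with constants independent of \<open>k\<close>:
  \<open>\<parallel>s\<^sub>k\<parallel> = O(d\<^sub>k)\<close>, \<open>\<parallel>\<nabla>f(x\<^sub>k\<^sub>+\<^sub>1)\<parallel> = O(\<parallel>s\<^sub>k\<parallel>\<^sup>2)\<close> and, by the error bound,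
  \<open>d\<^sub>k\<^sub>+\<^sub>1 = O(\<parallel>\<nabla>f(x\<^sub>k\<^sub>+\<^sub>1)\<parallel>)\<close>; the first and the last hold for large \<open>k\<close>. Together they
  give \<open>d\<^sub>k\<^sub>+\<^sub>1 = O(d\<^sub>k\<^sup>2)\<close>. Once \<open>d\<^sub>k\<close> is small it therefore decays at least geometrically, and so
  do the steps; the sequence converges, and its distance to the limit is comparable to \<open>d\<^sub>k\<close>
  (\<open>converges_Q_quadratically_via_infdist\<close>). Points of \<open>X\<close> need not be isolated; this is why the
  argument goes through \<open>d\<^sub>k\<close> rather than the distance to a prescribed limit.

  That \<open>d\<^sub>k\<close> tends to zero in the first place is a compactness argument. Each step decreases \<open>f\<close> by a
  multiple of \<open>\<parallel>s\<^sub>k\<parallel>\<^sup>3\<close>, and \<open>f\<close> is bounded below, so \<open>s\<^sub>k\<close> tends to zero. At \<open>x\<^sub>k\<close> the Hessian is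
  bounded below by \<open>- O(\<parallel>s\<^sub>k\<parallel>)\<close>; with the gradient estimate, every limit point lies in \<open>X\<close>
  (\<open>limit_point_second_order\<close>).

  The facts about a step come from the global minimality of \<open>s\<^sub>k\<close> for the cubic model. Instead of
  deriving optimality conditions, the model value at \<open>s\<^sub>k\<close> is compared with that at a few
  well-chosen other points. The estimate
  \<open>\<parallel>s\<^sub>k\<parallel> = O(d\<^sub>k)\<close> arises in this way from a comparison with the step to a nearest point of \<open>X\<close>
  (\<open>cubic_minimizer_norm_le\<close>). This comparison and the one behind
  the gradient estimate use that the Hessian is symmetric (\<open>hess_symmetric\<close>), and the transfer between Hessians at different points uses their Lipschitz
  continuity on the convex set \<open>F\<close>.
\<close>

section \<open>Global minimizers of a cubic model\<close>

text \<open>The cubic model without its constant term and as a function of the step from the current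
  iterate. Gradient and Hessian are arbitrary here, so that what follows about minimizers of the
  model is pure algebra.\<close>

definition cubic :: "real^'n \<Rightarrow> real^'n^'n \<Rightarrow> real \<Rightarrow> real^'n \<Rightarrow> real" where
  "cubic g H \<sigma> s = g \<bullet> s + 1/2 * (s \<bullet> (H *v s)) + \<sigma> / 6 * norm s ^ 3"

lemma matrix_vector_mult_minus_right: "(A::real^'n^'m) *v (- v) = - (A *v v)"
  using matrix_vector_mult_scaleR[of A "-1" v] by simp

text \<open>The minimizer \<open>s\<close> is compared with its reflection \<open>- s\<close>, which shows that the linear term is not
  positive, and with \<open>s / 2\<close>, where the cubic term shrinks by a larger factor
  than the others.\<close>

lemma cubic_minimizer_value:
  assumes min: "\<And>h. cubic g H \<sigma> s \<le> cubic g H \<sigma> h"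
  shows "cubic g H \<sigma> s \<le> - (\<sigma> / 36 * norm s ^ 3)"
proof -
  define a b c where "a = g \<bullet> s" and "b = s \<bullet> (H *v s)" and "c = \<sigma> * norm s ^ 3"
  have s: "cubic g H \<sigma> s = a + b / 2 + c / 6"
    by (simp add: cubic_def a_def b_def c_def)
  have "cubic g H \<sigma> (- s) = - a + b / 2 + c / 6"
    by (simp add: cubic_def a_def b_def c_def matrix_vector_mult_minus_right)
  with min[of "- s"] s have 1: "a \<le> 0" by simp
  have "cubic g H \<sigma> ((1/2) *\<^sub>R s) = a / 2 + b / 8 + c / 48"
    by (simp add: cubic_def a_def b_def c_def matrix_vector_mult_scaleR power_divide)
  with min[of "(1/2) *\<^sub>R s"] s have "a + b / 2 + c / 6 \<le> a / 2 + b / 8 + c / 48" by simp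
  with 1 have "a + b / 2 + c / 6 \<le> - (c / 36)" by argo
  then show ?thesis by (simp add: s c_def)
qed

lemma cubic_shift:
  assumes sym: "\<And>u v. u \<bullet> (H *v v) = v \<bullet> (H *v u)"
  shows "cubic g H \<sigma> (s + h) - cubic g H \<sigma> s =
    (g + H *v s) \<bullet> h + 1/2 * (h \<bullet> (H *v h)) + \<sigma> / 6 * (norm (s + h) ^ 3 - norm s ^ 3)"
  using sym[of s h]
  by (simp add: cubic_def inner_add_left inner_add_right matrix_vector_right_distrib
      inner_commute[of "H *v s" h] algebra_simps)

text \<open>The first-order condition would read \<open>g + H s + (\<sigma> / 2) \<parallel>s\<parallel> s = 0\<close>. Only the norm of \<open>g + H s\<close>
  matters, and it can be bounded without differentiating the cubed norm: moving from \<open>s\<close> a short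
  distance \<open>t\<close> against the direction of \<open>g + H s\<close> gains \<open>t \<parallel>g + H s\<parallel>\<close> to first order and costs at
  most \<open>t (\<sigma> / 2) \<parallel>s\<parallel>\<^sup>2\<close>.\<close>

lemma cubic_minimizer_gradient:
  assumes sym: "\<And>u v. u \<bullet> (H *v v) = v \<bullet> (H *v u)"
    and \<sigma>: "0 \<le> \<sigma>"
    and min: "\<And>h. cubic g H \<sigma> s \<le> cubic g H \<sigma> h"
  shows "norm (g + H *v s) \<le> \<sigma> / 2 * (norm s)\<^sup>2"
proof -
  define w where "w = g + H *v s"
  \<comment> \<open>The value \<open>sgn 0 = 0\<close> makes the case \<open>w = 0\<close> harmless.\<close>
  define u where "u = sgn w"
  define C where "C = \<bar>u \<bullet> (H *v u)\<bar>"
  have wu: "w \<bullet> u = norm w"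
    by (cases "w = 0") (auto simp: u_def sgn_div_norm dot_square_norm power2_eq_square)
  have nu: "norm u \<le> 1" by (simp add: u_def norm_sgn)
  have bound: "norm w \<le> \<sigma> / 2 * (norm s)\<^sup>2 + t * (C / 2 + \<sigma> / 6 * (3 * norm s + t))"
    if t: "t > 0" for t
  proof -
    have "norm (s - t *\<^sub>R u) \<le> norm s + t * norm u"
      using norm_triangle_ineq4[of s "t *\<^sub>R u"] t by simp
    also have "\<dots> \<le> norm s + t"
      using nu t mult_left_mono[of "norm u" 1 t] by simp
    finally have "norm (s - t *\<^sub>R u) ^ 3 \<le> (norm s + t) ^ 3"
      by (intro power_mono) auto
    then have "\<sigma> / 6 * (norm (s - t *\<^sub>R u) ^ 3 - norm s ^ 3) \<le> \<sigma> / 6 * ((norm s + t) ^ 3 - norm s ^ 3)"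
      using \<sigma> by (intro mult_left_mono) auto
    moreover have "0 \<le> - (t * norm w) + 1/2 * (t\<^sup>2 * (u \<bullet> (H *v u)))
        + \<sigma> / 6 * (norm (s - t *\<^sub>R u) ^ 3 - norm s ^ 3)"
      using cubic_shift[OF sym, of g \<sigma> s "- (t *\<^sub>R u)"] min[of "s + - (t *\<^sub>R u)"] wu
      by (simp add: w_def[symmetric] matrix_vector_mult_minus_right matrix_vector_mult_scaleR
          power2_eq_square)
    moreover have "t\<^sup>2 * (u \<bullet> (H *v u)) \<le> t\<^sup>2 * C"
      by (intro mult_left_mono) (auto simp: C_def)
    ultimately have "t * norm w \<le> 1/2 * (t\<^sup>2 * C) + \<sigma> / 6 * ((norm s + t) ^ 3 - norm s ^ 3)"
      by linarith
    also have "\<dots> = t * (\<sigma> / 2 * (norm s)\<^sup>2 + t * (C / 2 + \<sigma> / 6 * (3 * norm s + t)))"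
      by (simp add: field_simps power2_eq_square power3_eq_cube)
    finally show ?thesis using t by simp
  qed
  have "((\<lambda>t. \<sigma> / 2 * (norm s)\<^sup>2 + t * (C / 2 + \<sigma> / 6 * (3 * norm s + t)))
      \<longlongrightarrow> \<sigma> / 2 * (norm s)\<^sup>2 + 0 * (C / 2 + \<sigma> / 6 * (3 * norm s + 0))) (at_right 0)"
    by (intro tendsto_intros)
  moreover have "\<forall>\<^sub>F t in at_right 0. norm w \<le> \<sigma> / 2 * (norm s)\<^sup>2 + t * (C / 2 + \<sigma> / 6 * (3 * norm s + t))"
    using bound by (auto simp: eventually_at_filter)
  ultimately have "norm w \<le> \<sigma> / 2 * (norm s)\<^sup>2 + 0 * (C / 2 + \<sigma> / 6 * (3 * norm s + 0))"
    by (intro tendsto_lowerbound) auto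
  then show ?thesis by (simp add: w_def)
qed

text \<open>In \<open>m (s + h) + m (s - h) - 2 m s \<ge> 0\<close>, where \<open>m\<close> is the model, everything but \<open>h \<bullet> H h\<close> and
  the cubed norms cancels. Choosing \<open>\<parallel>h\<parallel> = t \<ge> \<parallel>s\<parallel>\<close> makes the cubed norms \<open>O(t\<^sup>3)\<close> while
  \<open>h \<bullet> H h\<close> scales like \<open>t\<^sup>2\<close>, so negative curvature of \<open>H\<close> is at most of order \<open>t\<close>. Allowing any
  \<open>t \<ge> \<parallel>s\<parallel>\<close> covers \<open>s = 0\<close>.\<close>

lemma cubic_minimizer_curvature:
  assumes \<sigma>: "0 \<le> \<sigma>"
    and min: "\<And>h. cubic g H \<sigma> s \<le> cubic g H \<sigma> h"
    and t: "0 < t" "norm s \<le> t"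
  shows "- (7 * \<sigma> / 3 * t * (norm v)\<^sup>2) \<le> v \<bullet> (H *v v)"
proof (cases "v = 0")
  case False
  define h where "h = (t / norm v) *\<^sub>R v"
  have nh: "norm h = t" using t False by (simp add: h_def)
  have shift: "norm (s + e) ^ 3 \<le> norm s ^ 3 + 7 * t ^ 3" if "norm e = t" for e
  proof -
    have "norm (s + e) ^ 3 \<le> (norm s + t) ^ 3"
      using norm_triangle_ineq[of s e] that by (intro power_mono) auto
    also have "\<dots> = norm s ^ 3 + (3 * ((norm s)\<^sup>2 * t) + 3 * (norm s * t\<^sup>2) + t ^ 3)"
      by (simp add: power2_eq_square power3_eq_cube algebra_simps)
    also have "(norm s)\<^sup>2 * t \<le> t\<^sup>2 * t" "norm s * t\<^sup>2 \<le> t * t\<^sup>2"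
      using t by (auto intro!: mult_right_mono power_mono)
    then have "3 * ((norm s)\<^sup>2 * t) + 3 * (norm s * t\<^sup>2) + t ^ 3 \<le> 7 * t ^ 3"
      by (simp add: power2_eq_square power3_eq_cube)
    finally show ?thesis by simp
  qed
  have "2 * cubic g H \<sigma> s \<le> cubic g H \<sigma> (s + h) + cubic g H \<sigma> (s + - h)"
    using min[of "s + h"] min[of "s + - h"] by linarith
  also have "\<dots> = 2 * (g \<bullet> s) + s \<bullet> (H *v s) + h \<bullet> (H *v h)
      + \<sigma> / 6 * (norm (s + h) ^ 3 + norm (s + - h) ^ 3)"
    by (simp add: cubic_def inner_diff_right inner_diff_left inner_add_right inner_add_left
        matrix_vector_right_distrib matrix_vector_mult_diff_distrib algebra_simps)
  also have "\<sigma> / 6 * (norm (s + h) ^ 3 + norm (s + - h) ^ 3)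
      \<le> \<sigma> / 6 * ((norm s ^ 3 + 7 * t ^ 3) + (norm s ^ 3 + 7 * t ^ 3))"
    using shift[of h] shift[of "- h"] nh \<sigma> by (intro mult_left_mono add_mono) auto
  finally have "0 \<le> h \<bullet> (H *v h) + 7 * \<sigma> / 3 * t ^ 3"
    by (simp add: cubic_def algebra_simps)
  also have "h \<bullet> (H *v h) = (t / norm v)\<^sup>2 * (v \<bullet> (H *v v))"
    by (simp add: h_def matrix_vector_mult_scaleR power2_eq_square)
  also have "(t / norm v)\<^sup>2 * (v \<bullet> (H *v v)) + 7 * \<sigma> / 3 * t ^ 3 =
      (t / norm v)\<^sup>2 * (v \<bullet> (H *v v) + 7 * \<sigma> / 3 * t * (norm v)\<^sup>2)"
    using False by (simp add: field_simps power2_eq_square power3_eq_cube)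
  finally show ?thesis
    using t False by (simp add: zero_le_mult_iff)
qed simp

text \<open>This bounds a step by the distance to a second-order point. In the application \<open>z\<close> is such a
  point near the iterate \<open>x\<close> and \<open>d = x - z\<close>; the Lipschitz Hessian turns \<open>\<nabla>f z = 0\<close> and
  \<open>\<nabla>\<^sup>2f z \<succeq> 0\<close> into the hypotheses on \<open>g\<close> and \<open>H\<close>. The step to \<open>z\<close> is \<open>- d\<close>, and the claim follows
  from \<open>m s \<le> m (- d)\<close>: with \<open>g \<approx> H d\<close> and symmetric \<open>H\<close>, the quadratic parts of both sides combine
  to \<open>- (s + d) \<bullet> H (s + d) / 2\<close>, which is almost nonpositive, so that \<open>\<parallel>s\<parallel>\<^sup>3\<close> is bounded by
  \<open>\<parallel>d\<parallel>\<^sup>3\<close> up to multiples of \<open>\<parallel>d\<parallel> \<parallel>s\<parallel>\<^sup>2\<close>.\<close>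

lemma cubic_minimizer_norm_le:
  assumes sym: "\<And>u v. u \<bullet> (H *v v) = v \<bullet> (H *v u)"
    and \<sigma>: "0 < \<sigma>" and L: "0 \<le> L"
    and min: "\<And>h. cubic g H \<sigma> s \<le> cubic g H \<sigma> h"
    and grad: "norm (g - H *v d) \<le> L * (norm d)\<^sup>2"
    and curv: "\<And>v. - (L * norm d * (norm v)\<^sup>2) \<le> v \<bullet> (H *v v)"
  shows "norm s \<le> (1 + 24 * L / \<sigma>) * norm d"
proof (cases "norm s \<le> norm d")
  case True
  also have "norm d \<le> (1 + 24 * L / \<sigma>) * norm d"
    using \<sigma> L by (simp add: algebra_simps)
  finally show ?thesis .
next
  case False
  define r D where "r = norm s" and "D = norm d"
  have rD: "0 \<le> D" "D < r" using False by (auto simp: r_def D_def)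
  define e where "e = g - H *v d"
  have sd: "norm (s + d) \<le> 2 * r"
    using norm_triangle_ineq[of s d] rD by (simp add: r_def D_def)
  have "\<sigma> / 6 * (r ^ 3 - D ^ 3) \<le> - (e \<bullet> (s + d)) + - (1/2 * ((s + d) \<bullet> (H *v (s + d))))"
    using min[of "- d"] sym[of s d]
    by (simp add: cubic_def e_def r_def D_def inner_diff_right inner_diff_left inner_add_right
        inner_add_left matrix_vector_right_distrib matrix_vector_mult_minus_right
        inner_commute[of "H *v d"] algebra_simps)
  also have "- (e \<bullet> (s + d)) \<le> (L * D\<^sup>2) * (2 * r)"
  proof -
    have "- (e \<bullet> (s + d)) \<le> norm e * norm (s + d)"
      using Cauchy_Schwarz_ineq2[of e "s + d"] by linarith
    also have "\<dots> \<le> (L * D\<^sup>2) * (2 * r)"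
      using grad sd L by (intro mult_mono) (auto simp: e_def D_def)
    finally show ?thesis .
  qed
  also have "- (1/2 * ((s + d) \<bullet> (H *v (s + d)))) \<le> 1/2 * (L * D * (2 * r)\<^sup>2)"
  proof -
    have "L * D * (norm (s + d))\<^sup>2 \<le> L * D * (2 * r)\<^sup>2"
      using sd L rD by (intro mult_left_mono power_mono) auto
    with curv[of "s + d"] show ?thesis by (simp add: D_def)
  qed
  finally have "\<sigma> * r ^ 3 \<le> \<sigma> * D ^ 3 + 12 * L * (D * D * r) + 12 * L * (D * r\<^sup>2)"
    by (simp add: power2_eq_square algebra_simps)
  also have "\<dots> \<le> \<sigma> * (D * r\<^sup>2) + 12 * L * (D * r\<^sup>2) + 12 * L * (D * r\<^sup>2)"
  proof -
    have "D * (D * D) \<le> D * (r * r)" "D * (D * r) \<le> D * (r * r)"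
      using rD by (auto intro!: mult_left_mono mult_mono)
    then have "D ^ 3 \<le> D * r\<^sup>2" "D * D * r \<le> D * r\<^sup>2"
      by (simp_all add: power2_eq_square power3_eq_cube mult.assoc)
    then show ?thesis
      using \<sigma> L rD by (intro add_mono mult_left_mono) auto
  qed
  finally have "r\<^sup>2 * (\<sigma> * r) \<le> r\<^sup>2 * ((\<sigma> + 24 * L) * D)"
    by (simp add: power2_eq_square power3_eq_cube algebra_simps)
  then have "\<sigma> * r \<le> (\<sigma> + 24 * L) * D"
    using rD by simp
  then show ?thesis
    using \<sigma> by (simp add: r_def D_def field_simps)
qed

section \<open>Symmetry of the Hessian\<close>

text \<open>By the mean value theorem applied to the difference in direction \<open>v\<close>, the mixed second
  difference of \<open>f\<close> is \<open>t\<close> times a difference of gradients, which the linearization of the gradient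
  at \<open>x\<close> identifies as \<open>t\<^sup>2 (u \<bullet> H v)\<close> up to a small multiple of \<open>t\<^sup>2\<close>.\<close>

lemma second_difference_bound:
  fixes f :: "real^'n \<Rightarrow> real"
  assumes diff: "\<And>y. f differentiable (at y)"
    and t: "0 < t" "t * (norm u + norm v) < \<delta>" and e: "0 \<le> e"
    and rem: "\<And>h. norm h < \<delta> \<Longrightarrow> norm (grad f (x + h) - grad f x - H *v h) \<le> e * norm h"
  shows "\<bar>f (x + t *\<^sub>R u + t *\<^sub>R v) - f (x + t *\<^sub>R u) - f (x + t *\<^sub>R v) + f x - t\<^sup>2 * (u \<bullet> (H *v v))\<bar>
    \<le> t\<^sup>2 * (2 * e * (norm u + norm v)\<^sup>2)"
proof -
  define q where "q \<tau> = f (x + \<tau> *\<^sub>R u + t *\<^sub>R v) - f (x + \<tau> *\<^sub>R u)" for \<tau>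
  define N where "N = norm u + norm v"
  have fd: "(f has_derivative (\<lambda>h. h \<bullet> grad f y)) (at y)" for y
    using GDERIV_grad[OF diff] by (simp add: gderiv_def)
  have "(q has_real_derivative u \<bullet> (grad f (x + \<tau> *\<^sub>R u + t *\<^sub>R v) - grad f (x + \<tau> *\<^sub>R u))) (at \<tau>)" for \<tau>
    unfolding q_def has_field_derivative_def
    by (rule derivative_eq_intros has_derivative_compose[OF _ fd] refl)+
      (auto simp: algebra_simps)
  then obtain \<xi> where \<xi>: "0 < \<xi>" "\<xi> < t"
    and q: "q t - q 0 = t * (u \<bullet> (grad f (x + \<xi> *\<^sub>R u + t *\<^sub>R v) - grad f (x + \<xi> *\<^sub>R u)))"
    using MVT2[of 0 t q] t by fastforce
  define h\<^sub>1 h\<^sub>2 where "h\<^sub>1 = \<xi> *\<^sub>R u + t *\<^sub>R v" and "h\<^sub>2 = \<xi> *\<^sub>R u"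
  have "\<xi> * norm u \<le> t * norm u" using \<xi> by (intro mult_right_mono) auto
  moreover have "norm h\<^sub>1 \<le> \<xi> * norm u + t * norm v"
    using norm_triangle_ineq[of "\<xi> *\<^sub>R u" "t *\<^sub>R v"] \<xi> t by (simp add: h\<^sub>1_def)
  moreover have "norm h\<^sub>2 = \<xi> * norm u" using \<xi> by (simp add: h\<^sub>2_def)
  moreover have "0 \<le> t * norm v" using t by simp
  ultimately have h: "norm h\<^sub>1 \<le> t * N" "norm h\<^sub>2 \<le> t * N"
    by (auto simp: N_def algebra_simps)
  define r where "r h = grad f (x + h) - grad f x - H *v h" for h
  have r: "norm (r h) \<le> e * (t * N)" if "norm h \<le> t * N" for h
    using rem[of h] that t mult_left_mono[OF that e] by (simp add: r_def N_def)
  have "H *v h\<^sub>1 - H *v h\<^sub>2 = t *\<^sub>R (H *v v)"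
    by (simp add: h\<^sub>1_def h\<^sub>2_def matrix_vector_right_distrib matrix_vector_mult_scaleR)
  then have "grad f (x + h\<^sub>1) - grad f (x + h\<^sub>2) = t *\<^sub>R (H *v v) + (r h\<^sub>1 - r h\<^sub>2)"
    by (simp add: r_def algebra_simps)
  moreover have "q t - q 0 = t * (u \<bullet> (grad f (x + h\<^sub>1) - grad f (x + h\<^sub>2)))"
    using q by (simp add: h\<^sub>1_def h\<^sub>2_def add.assoc)
  ultimately have "q t - q 0 - t\<^sup>2 * (u \<bullet> (H *v v)) = t * (u \<bullet> (r h\<^sub>1 - r h\<^sub>2))"
    by (simp add: inner_add_right power2_eq_square distrib_left)
  also have "\<bar>\<dots>\<bar> \<le> t * (N * (2 * e * (t * N)))"
  proof -
    have "norm (r h\<^sub>1 - r h\<^sub>2) \<le> 2 * e * (t * N)"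
      using norm_triangle_ineq4[of "r h\<^sub>1" "r h\<^sub>2"] r[OF h(1)] r[OF h(2)] by simp
    then have "norm u * norm (r h\<^sub>1 - r h\<^sub>2) \<le> N * (2 * e * (t * N))"
      by (intro mult_mono) (auto simp: N_def)
    then have "\<bar>u \<bullet> (r h\<^sub>1 - r h\<^sub>2)\<bar> \<le> N * (2 * e * (t * N))"
      using Cauchy_Schwarz_ineq2 order_trans by blast
    then show ?thesis using t by (simp add: abs_mult)
  qed
  finally show ?thesis
    by (simp add: q_def N_def power2_eq_square algebra_simps)
qed

text \<open>The mixed second difference of \<open>f\<close> is symmetric in \<open>u\<close> and \<open>v\<close>, and it determines the
  bilinear form of the Hessian in the limit of small increments.\<close>

lemma hess_symmetric:
  fixes f :: "real^'n \<Rightarrow> real"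
  assumes diff: "\<And>y. f differentiable (at y)" and gdiff: "grad f differentiable (at x)"
  shows "u \<bullet> (hess f x *v v) = v \<bullet> (hess f x *v u)"
proof -
  define N where "N = norm u + norm v"
  have le: "\<bar>u \<bullet> (hess f x *v v) - v \<bullet> (hess f x *v u)\<bar> \<le> 4 * N\<^sup>2 * e" if e: "e > 0" for e
  proof -
    obtain \<delta> where \<delta>: "\<delta> > 0"
      and rem0: "\<And>y. norm (y - x) < \<delta> \<Longrightarrow>
        norm (grad f y - grad f x - hess f x *v (y - x)) \<le> e * norm (y - x)"
      using has_derivative_hess[OF gdiff] e unfolding has_derivative_at_alt by blast
    have rem: "norm (grad f (x + h) - grad f x - hess f x *v h) \<le> e * norm h"
      if "norm h < \<delta>" for h
      using rem0[of "x + h"] that by simp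
    \<comment> \<open>The summand 1 allows \<open>u = v = 0\<close>.\<close>
    define t where "t = \<delta> / (N + 1)"
    have N: "N \<ge> 0" by (simp add: N_def)
    have t: "t > 0" using \<delta> N by (simp add: t_def)
    have tN: "t * N < \<delta>" using \<delta> N by (simp add: t_def field_simps)
    define \<Delta> where "\<Delta> = f (x + t *\<^sub>R u + t *\<^sub>R v) - f (x + t *\<^sub>R u) - f (x + t *\<^sub>R v) + f x"
    have "\<bar>\<Delta> - t\<^sup>2 * (u \<bullet> (hess f x *v v))\<bar> \<le> t\<^sup>2 * (2 * e * N\<^sup>2)"
      using second_difference_bound[OF diff t _ _ rem, of u v] tN e
      by (simp add: \<Delta>_def N_def)
    moreover have "\<bar>\<Delta> - t\<^sup>2 * (v \<bullet> (hess f x *v u))\<bar> \<le> t\<^sup>2 * (2 * e * N\<^sup>2)"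
      using second_difference_bound[OF diff t _ _ rem, of v u] tN e
      by (simp add: \<Delta>_def N_def algebra_simps)
    ultimately have "\<bar>t\<^sup>2 * (u \<bullet> (hess f x *v v)) - t\<^sup>2 * (v \<bullet> (hess f x *v u))\<bar> \<le> t\<^sup>2 * (4 * N\<^sup>2 * e)"
      by (simp add: algebra_simps abs_le_iff)
    then have "t\<^sup>2 * \<bar>u \<bullet> (hess f x *v v) - v \<bullet> (hess f x *v u)\<bar> \<le> t\<^sup>2 * (4 * N\<^sup>2 * e)"
      by (simp add: abs_mult flip: right_diff_distrib)
    then show ?thesis using t by simp
  qed
  have "((\<lambda>e. 4 * N\<^sup>2 * e) \<longlongrightarrow> 4 * N\<^sup>2 * 0) (at_right 0)"
    by (intro tendsto_intros)
  moreover have "\<forall>\<^sub>F e in at_right 0. \<bar>u \<bullet> (hess f x *v v) - v \<bullet> (hess f x *v u)\<bar> \<le> 4 * N\<^sup>2 * e"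
    using le by (auto simp: eventually_at_filter)
  ultimately have "\<bar>u \<bullet> (hess f x *v v) - v \<bullet> (hess f x *v u)\<bar> \<le> 4 * N\<^sup>2 * 0"
    by (intro tendsto_lowerbound) auto
  then show ?thesis by simp
qed

section \<open>Consequences of Hessian regularity\<close>

text \<open>The mean value inequality along the segment from \<open>x\<close> to \<open>y\<close>, on which the derivative
  \<open>hess f z - hess f x\<close> of \<open>grad f z - hess f x *v z\<close> is at most \<open>L \<parallel>y - x\<parallel>\<close>. This gives the
  constant \<open>L\<close> instead of the sharp \<open>L / 2\<close>, which affects constants only.\<close>

lemma grad_linearization_error:
  fixes f :: "real^'n \<Rightarrow> real"
  assumes diff: "\<And>y. grad f differentiable (at y)"
    and F: "convex F" "x \<in> F" "y \<in> F" and L: "0 \<le> L"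
    and lip: "\<And>z. z \<in> F \<Longrightarrow> onorm ((*v) (hess f z - hess f x)) \<le> L * norm (z - x)"
  shows "norm (grad f y - grad f x - hess f x *v (y - x)) \<le> L * (norm (y - x))\<^sup>2"
proof -
  let ?S = "closed_segment x y"
  have S: "?S \<subseteq> F" using F by (simp add: closed_segment_subset)
  have "norm ((grad f y - hess f x *v y) - (grad f x - hess f x *v x)) \<le> (L * norm (y - x)) * norm (y - x)"
  proof (rule differentiable_bound[where S = ?S and f' = "\<lambda>z. (*v) (hess f z - hess f x)"])
    fix z assume z: "z \<in> ?S"
    have "(grad f has_derivative (*v) (hess f z)) (at z within ?S)"
      using has_derivative_hess[OF diff] by (rule has_derivative_at_withinI)
    moreover have "((*v) (hess f x) has_derivative (*v) (hess f x)) (at z within ?S)"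
      by (rule bounded_linear_imp_has_derivative) simp
    moreover have "(*v) (hess f z - hess f x) = (\<lambda>h. hess f z *v h - hess f x *v h)"
      by (simp add: fun_eq_iff matrix_vector_mult_diff_rdistrib)
    ultimately show "((\<lambda>z. grad f z - hess f x *v z) has_derivative (*v) (hess f z - hess f x)) (at z within ?S)"
      by (simp add: has_derivative_diff)
    have "onorm ((*v) (hess f z - hess f x)) \<le> L * norm (z - x)"
      using lip z S by blast
    also have "\<dots> \<le> L * norm (y - x)"
      using segment_bound(1)[OF z] L by (intro mult_left_mono) (auto simp: norm_minus_commute)
    finally show "onorm ((*v) (hess f z - hess f x)) \<le> L * norm (y - x)" .
  qed auto
  then show ?thesis
    by (simp add: matrix_vector_mult_diff_distrib power2_eq_square algebra_simps)
qed

lemma quadratic_form_perturbation: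
  fixes A B :: "real^'n^'n"
  shows "v \<bullet> (B *v v) - onorm ((*v) (A - B)) * (norm v)\<^sup>2 \<le> v \<bullet> (A *v v)"
proof -
  have "\<bar>v \<bullet> ((A - B) *v v)\<bar> \<le> norm v * norm ((A - B) *v v)"
    by (rule Cauchy_Schwarz_ineq2)
  also have "\<dots> \<le> norm v * (onorm ((*v) (A - B)) * norm v)"
    by (intro mult_left_mono onorm) auto
  finally show ?thesis
    by (simp add: matrix_vector_mult_diff_rdistrib inner_diff_right power2_eq_square algebra_simps
        abs_le_iff)
qed

lemma tendsto_matrix_vector_mult:
  fixes A :: "'a \<Rightarrow> real^'n^'m"
  assumes "(A \<longlongrightarrow> B) G"
  shows "((\<lambda>k. A k *v v) \<longlongrightarrow> B *v v) G"
  unfolding matrix_vector_mult_def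
  using assms by (intro vec_tendstoI) (auto intro!: tendsto_intros)

lemma isCont_grad: "twice_cont_diff f \<Longrightarrow> isCont (grad f) z"
  by (simp add: twice_cont_diff_def differentiable_imp_continuous_within)

lemma isCont_hess: "twice_cont_diff f \<Longrightarrow> isCont (hess f) z"
  by (simp add: twice_cont_diff_def continuous_on_eq_continuous_at)

lemma closed_second_order_points:
  assumes "twice_cont_diff f"
  shows "closed (second_order_points f)"
  unfolding closed_sequential_limits
proof safe
  fix y z assume y: "\<forall>n. y n \<in> second_order_points f" and lim: "y \<longlonglongrightarrow> z"
  have g: "(\<lambda>n. grad f (y n)) \<longlonglongrightarrow> grad f z"
    using isCont_tendsto_compose[OF isCont_grad[OF assms] lim] .
  have "grad f z = 0"
    using g y by (simp add: second_order_points_def LIMSEQ_const_iff)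
  moreover have "0 \<le> v \<bullet> (hess f z *v v)" for v
  proof (rule LIMSEQ_le_const)
    show "(\<lambda>n. v \<bullet> (hess f (y n) *v v)) \<longlonglongrightarrow> v \<bullet> (hess f z *v v)"
      by (intro tendsto_intros tendsto_matrix_vector_mult
          isCont_tendsto_compose[OF isCont_hess[OF assms] lim])
  qed (use y in \<open>auto simp: second_order_points_def psd_def\<close>)
  ultimately show "z \<in> second_order_points f"
    by (simp add: second_order_points_def psd_def)
qed

section \<open>From decay of the distance to a set to quadratic convergence\<close>

text \<open>Let \<open>d k\<close> be the distance of \<open>w k\<close> to \<open>S\<close>. Once \<open>d k < 1 / (2 A)\<close>, the quadratic bound gives
  \<open>d (k + 1) \<le> d k / 2\<close>, hence \<open>c (d k) \<le> 2 c (d k - d (k + 1))\<close>: the step bound telescopes, the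
  sequence is Cauchy, and its limit \<open>l\<close> satisfies \<open>\<parallel>w k - l\<parallel> \<le> 2 c (d k)\<close>. As \<open>l\<close> lies in \<open>S\<close>, also
  \<open>d k \<le> \<parallel>w k - l\<parallel>\<close>, so the distance to \<open>S\<close> and the distance to \<open>l\<close> are equivalent and the
  quadratic decay of the former is one of the latter.\<close>

lemma converges_Q_quadratically_via_infdist:
  fixes w :: "nat \<Rightarrow> 'a::banach"
  assumes S: "closed S" "S \<noteq> {}"
    and lim: "(\<lambda>k. infdist (w k) S) \<longlonglongrightarrow> 0"
    and c: "c > 0" and A: "A > 0"
    and step: "\<forall>\<^sub>F k in sequentially. norm (w (Suc k) - w k) \<le> c * infdist (w k) S"
    and quad: "\<forall>\<^sub>F k in sequentially. infdist (w (Suc k)) S \<le> A * (infdist (w k) S)\<^sup>2"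
  shows "\<exists>l\<in>S. converges_Q_quadratically w l"
proof -
  define d where "d = (\<lambda>k. infdist (w k) S)"
  have d0: "0 \<le> d k" for k by (simp add: d_def infdist_nonneg)
  have dlim: "d \<longlonglongrightarrow> 0" using lim by (simp add: d_def)
  have "\<forall>\<^sub>F k in sequentially. d k < 1 / (2 * A)"
    using dlim A by (intro order_tendstoD) auto
  with step quad have "\<forall>\<^sub>F k in sequentially. d k < 1 / (2 * A) \<and>
      norm (w (Suc k) - w k) \<le> c * d k \<and> d (Suc k) \<le> A * (d k)\<^sup>2"
    by eventually_elim (simp add: d_def)
  then obtain K where K: "d k < 1 / (2 * A)" "norm (w (Suc k) - w k) \<le> c * d k"
      "d (Suc k) \<le> A * (d k)\<^sup>2" if "k \<ge> K" for k
    by (auto simp: eventually_sequentially)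
  have half: "d (Suc k) \<le> d k / 2" if "k \<ge> K" for k
  proof -
    have "A * d k \<le> 1 / 2" using K(1)[OF that] A by (simp add: field_simps)
    then have "A * d k * d k \<le> 1 / 2 * d k" using d0 by (intro mult_right_mono) auto
    then show ?thesis using K(3)[OF that] by (simp add: power2_eq_square)
  qed
  have tail: "norm (w (k + j) - w k) \<le> 2 * c * (d k - d (k + j))" if "k \<ge> K" for k j
  proof (induction j)
    case (Suc j)
    have "norm (w (k + Suc j) - w k) \<le> norm (w (Suc (k + j)) - w (k + j)) + norm (w (k + j) - w k)"
      using norm_triangle_ineq[of "w (Suc (k + j)) - w (k + j)" "w (k + j) - w k"] by simp
    also have "\<dots> \<le> c * d (k + j) + 2 * c * (d k - d (k + j))"
      using K(2)[of "k + j"] that Suc by (intro add_mono) auto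
    also have "\<dots> = c * (2 * d k - d (k + j))" by (simp add: algebra_simps)
    also have "\<dots> \<le> c * (2 * d k - 2 * d (Suc (k + j)))"
      using half[of "k + j"] that c by (intro mult_left_mono) auto
    finally show ?case by (simp add: algebra_simps)
  qed simp
  have tail': "norm (w m - w k) \<le> 2 * c * d k" if "k \<ge> K" "m \<ge> k" for k m
  proof -
    have "norm (w m - w k) \<le> 2 * c * (d k - d m)" using tail[of k "m - k"] that by simp
    also have "\<dots> \<le> 2 * c * d k" using c d0 by (simp add: algebra_simps)
    finally show ?thesis .
  qed
  have "Cauchy w"
  proof (rule CauchyI')
    fix e :: real assume "e > 0"
    then have "\<forall>\<^sub>F k in sequentially. d k < e / (2 * c)"
      using dlim c by (intro order_tendstoD) auto
    then obtain N where N: "d k < e / (2 * c)" if "k \<ge> N" for k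
      by (auto simp: eventually_sequentially)
    have "norm (w m - w n) < e" if "m \<ge> max N K" "n > m" for m n
    proof -
      have "norm (w m - w n) \<le> 2 * c * d m" using tail'[of m n] that by (simp add: norm_minus_commute)
      also have "\<dots> < e" using N[of m] that c by (simp add: field_simps)
      finally show ?thesis .
    qed
    then show "\<exists>M. \<forall>m\<ge>M. \<forall>n>m. dist (w m) (w n) < e"
      unfolding dist_norm by blast
  qed
  then obtain l where l: "w \<longlonglongrightarrow> l"
    by (auto simp: Cauchy_convergent_iff convergent_def)
  have "d \<longlonglongrightarrow> infdist l S"
    unfolding d_def using l by (intro tendsto_infdist)
  with dlim have "infdist l S = 0" using LIMSEQ_unique by blast
  with S have lS: "l \<in> S" by (simp add: in_closed_iff_infdist_zero)
  have err: "norm (w k - l) \<le> 2 * c * d k" if "k \<ge> K" for k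
  proof (rule Lim_bounded)
    show "(\<lambda>m. norm (w k - w m)) \<longlonglongrightarrow> norm (w k - l)"
      using l by (intro tendsto_intros)
    show "\<forall>m\<ge>k. norm (w k - w m) \<le> 2 * c * d k"
      using tail'[OF that] by (simp add: norm_minus_commute)
  qed
  have "norm (w (Suc k) - l) \<le> (2 * c * A) * (norm (w k - l))\<^sup>2" if "k \<ge> K" for k
  proof -
    have "norm (w (Suc k) - l) \<le> 2 * c * d (Suc k)" using err[of "Suc k"] that by simp
    also have "\<dots> \<le> 2 * c * (A * (norm (w k - l))\<^sup>2)"
    proof -
      have "d k \<le> norm (w k - l)" using infdist_le[OF lS, of "w k"] by (simp add: d_def dist_norm)
      then have "A * (d k)\<^sup>2 \<le> A * (norm (w k - l))\<^sup>2" using A d0 by (intro mult_left_mono power_mono) auto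
      then show ?thesis using K(3)[OF that] c by (intro mult_left_mono) auto
    qed
    finally show ?thesis by (simp add: mult.assoc)
  qed
  then have "\<forall>\<^sub>F k in sequentially. norm (w (Suc k) - l) \<le> (2 * c * A) * (norm (w k - l))\<^sup>2"
    by (auto simp: eventually_sequentially)
  with l c A have "converges_Q_quadratically w l"
    unfolding converges_Q_quadratically_def by (intro conjI exI[of _ "2 * c * A"]) auto
  with lS show ?thesis by blast
qed

section \<open>The iterates of the cubic regularization method\<close>

text \<open>A run of the method with its sequence \<open>\<sigma>\<close> of regularization parameters made explicit, and with
  the two defining properties of an iteration (the step minimizes the model; the model value is not
  exceeded by \<open>f\<close>) expressed by the step \<open>x (Suc k) - x k\<close>.\<close>

locale cubic_regularization_run =
  fixes f :: "real^'n \<Rightarrow> real" and F :: "(real^'n) set" and L \<sigma>bar :: real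
    and \<sigma> :: "nat \<Rightarrow> real" and x :: "nat \<Rightarrow> real^'n"
  assumes smooth: "twice_cont_diff f"
    and F: "convex F" "sublevel f (f (x 0)) \<subseteq> interior F"
    and L: "0 < L"
    and lipschitz: "\<And>y z. y \<in> F \<Longrightarrow> z \<in> F \<Longrightarrow> onorm ((*v) (hess f y - hess f z)) \<le> L * norm (y - z)"
    and \<sigma>bar: "0 < \<sigma>bar"
    and \<sigma>: "\<And>k. \<sigma>bar \<le> \<sigma> k" "\<And>k. \<sigma> k \<le> 2 * L"
    and minimizer: "\<And>k h. cubic (grad f (x k)) (hess f (x k)) (\<sigma> k) (x (Suc k) - x k)
        \<le> cubic (grad f (x k)) (hess f (x k)) (\<sigma> k) h"
    and accepted: "\<And>k. f (x (Suc k)) \<le>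
        f (x k) + cubic (grad f (x k)) (hess f (x k)) (\<sigma> k) (x (Suc k) - x k)"
begin

lemma \<sigma>_pos: "0 < \<sigma> k"
  using \<sigma>(1)[of k] \<sigma>bar by simp

lemma hess_sym: "u \<bullet> (hess f z *v v) = v \<bullet> (hess f z *v u)"
  using smooth by (intro hess_symmetric) (auto simp: twice_cont_diff_def)

lemma continuous_f: "continuous_on UNIV f"
  using smooth
  by (auto simp: twice_cont_diff_def continuous_on_eq_continuous_at intro: differentiable_imp_continuous_within)

lemma decrease: "f (x (Suc k)) \<le> f (x k) - \<sigma>bar / 36 * norm (x (Suc k) - x k) ^ 3"
proof -
  have "\<sigma>bar / 36 * norm (x (Suc k) - x k) ^ 3 \<le> \<sigma> k / 36 * norm (x (Suc k) - x k) ^ 3"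
    using \<sigma>(1)[of k] by (intro mult_right_mono) auto
  with accepted[of k] cubic_minimizer_value[OF minimizer, of k] show ?thesis by linarith
qed

lemma decseq_f: "decseq (\<lambda>k. f (x k))"
proof (rule decseq_SucI)
  fix k
  have "0 \<le> \<sigma>bar / 36 * norm (x (Suc k) - x k) ^ 3" using \<sigma>bar by simp
  with decrease[of k] show "f (x (Suc k)) \<le> f (x k)" by linarith
qed

lemma sublevel_mono: "j \<le> k \<Longrightarrow> x k \<in> sublevel f (f (x j))"
  using decseq_f by (auto simp: sublevel_def decseq_def)

lemma iterate_in_F: "x k \<in> F"
  using sublevel_mono[of 0 k] F interior_subset by blast

text \<open>The decreasing values \<open>f (x k)\<close> converge, and each decrease controls the cube of the step
  length.\<close>

lemma steps_tendsto_0: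
  assumes "\<And>y. B \<le> f y"
  shows "(\<lambda>k. norm (x (Suc k) - x k)) \<longlonglongrightarrow> 0"
proof -
  define r where "r k = norm (x (Suc k) - x k)" for k
  obtain l where l: "(\<lambda>k. f (x k)) \<longlonglongrightarrow> l"
    by (rule decseq_convergent[OF decseq_f, of B]) (use assms in auto)
  have "(\<lambda>k. 36 / \<sigma>bar * (f (x k) - f (x (Suc k)))) \<longlonglongrightarrow> 36 / \<sigma>bar * (l - l)"
    using l by (intro tendsto_intros LIMSEQ_Suc[of "\<lambda>k. f (x k)"])
  then have "(\<lambda>k. 36 / \<sigma>bar * (f (x k) - f (x (Suc k)))) \<longlonglongrightarrow> 0" by simp
  then have "(\<lambda>k. r k ^ 3) \<longlonglongrightarrow> 0"
  proof (rule tendsto_sandwich[OF _ _ tendsto_const, rotated 2])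
    show "\<forall>\<^sub>F k in sequentially. 0 \<le> r k ^ 3" by (simp add: r_def)
    show "\<forall>\<^sub>F k in sequentially. r k ^ 3 \<le> 36 / \<sigma>bar * (f (x k) - f (x (Suc k)))"
      using decrease \<sigma>bar by (intro always_eventually) (simp add: r_def field_simps)
  qed
  then have "(\<lambda>k. root 3 (r k ^ 3)) \<longlonglongrightarrow> root 3 0"
    by (intro tendsto_intros)
  then show ?thesis by (simp add: r_def real_root_power_cancel)
qed

text \<open>The gradient at the new iterate differs from \<open>g + H s\<close> by the linearization error
  \<open>O(\<parallel>s\<parallel>\<^sup>2)\<close>, and \<open>g + H s\<close> is itself \<open>O(\<parallel>s\<parallel>\<^sup>2)\<close> because \<open>s\<close> minimizes the model. This is the
  source of the quadratic rate.\<close>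

lemma grad_next: "norm (grad f (x (Suc k))) \<le> 2 * L * (norm (x (Suc k) - x k))\<^sup>2"
proof -
  define s where "s = x (Suc k) - x k"
  have "norm (grad f (x (Suc k)) - grad f (x k) - hess f (x k) *v s) \<le> L * (norm s)\<^sup>2"
    unfolding s_def using smooth F L lipschitz iterate_in_F
    by (intro grad_linearization_error[where F = F]) (auto simp: twice_cont_diff_def)
  moreover have "norm (grad f (x k) + hess f (x k) *v s) \<le> \<sigma> k / 2 * (norm s)\<^sup>2"
    unfolding s_def using \<sigma>_pos by (intro cubic_minimizer_gradient minimizer hess_sym less_imp_le)
  moreover have "\<sigma> k / 2 * (norm s)\<^sup>2 \<le> L * (norm s)\<^sup>2"
    using \<sigma>(2)[of k] by (intro mult_right_mono) auto
  moreover have "norm (grad f (x (Suc k))) \<le> norm (grad f (x (Suc k)) - grad f (x k) - hess f (x k) *v s)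
      + norm (grad f (x k) + hess f (x k) *v s)"
    using norm_triangle_ineq[of "grad f (x (Suc k)) - grad f (x k) - hess f (x k) *v s"
        "grad f (x k) + hess f (x k) *v s"] by simp
  ultimately show ?thesis by (simp add: s_def)
qed

lemma step_le_dist:
  assumes z: "z \<in> second_order_points f" "z \<in> F"
  shows "norm (x (Suc k) - x k) \<le> (1 + 24 * L / \<sigma>bar) * norm (x k - z)"
proof -
  have "norm (x (Suc k) - x k) \<le> (1 + 24 * L / \<sigma> k) * norm (x k - z)"
  proof (rule cubic_minimizer_norm_le[OF hess_sym \<sigma>_pos _ minimizer])
    have "norm (grad f z - grad f (x k) - hess f (x k) *v (z - x k)) \<le> L * (norm (z - x k))\<^sup>2"
      using smooth F L lipschitz iterate_in_F z
      by (intro grad_linearization_error[where F = F]) (auto simp: twice_cont_diff_def)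
    moreover have "grad f z - grad f (x k) - hess f (x k) *v (z - x k)
        = - (grad f (x k) - hess f (x k) *v (x k - z))"
      using z by (simp add: second_order_points_def matrix_vector_mult_diff_distrib)
    ultimately show "norm (grad f (x k) - hess f (x k) *v (x k - z)) \<le> L * (norm (x k - z))\<^sup>2"
      by (simp only: norm_minus_cancel) (simp add: norm_minus_commute)
  next
    fix v :: "real^'n"
    have "onorm ((*v) (hess f (x k) - hess f z)) * (norm v)\<^sup>2 \<le> L * norm (x k - z) * (norm v)\<^sup>2"
      using lipschitz iterate_in_F z by (intro mult_right_mono) auto
    moreover have "0 \<le> v \<bullet> (hess f z *v v)"
      using z by (simp add: second_order_points_def psd_def)
    ultimately show "- (L * norm (x k - z) * (norm v)\<^sup>2) \<le> v \<bullet> (hess f (x k) *v v)"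
      using quadratic_form_perturbation[of v "hess f z" "hess f (x k)"] by linarith
  qed (use L in simp)
  also have "\<dots> \<le> (1 + 24 * L / \<sigma>bar) * norm (x k - z)"
    using \<sigma>(1)[of k] \<sigma>bar L by (intro mult_right_mono add_left_mono divide_left_mono) auto
  finally show ?thesis .
qed

text \<open>Both the gradient at the new iterate and the negative curvature at the old one are bounded in
  terms of the step length. As this tends to zero, old and new iterates share their limit points,
  and both bounds vanish in the limit.\<close>

lemma limit_point_second_order:
  assumes steps: "(\<lambda>k. norm (x (Suc k) - x k)) \<longlonglongrightarrow> 0"
    and \<phi>: "strict_mono \<phi>" and l: "(x \<circ> \<phi>) \<longlonglongrightarrow> l"
  shows "l \<in> second_order_points f"
proof -
  have sub: "(\<lambda>k. norm (x (Suc (\<phi> k)) - x (\<phi> k))) \<longlonglongrightarrow> 0"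
    using LIMSEQ_subseq_LIMSEQ[OF steps \<phi>] by (simp add: o_def)
  have l': "(\<lambda>k. x (\<phi> k)) \<longlonglongrightarrow> l" using l by (simp add: o_def)
  have "(\<lambda>k. (x (Suc (\<phi> k)) - x (\<phi> k)) + x (\<phi> k)) \<longlonglongrightarrow> 0 + l"
    using sub l' by (intro tendsto_add) (auto simp: tendsto_norm_zero_iff)
  then have next_l: "(\<lambda>k. x (Suc (\<phi> k))) \<longlonglongrightarrow> l" by simp
  have "(\<lambda>k. grad f (x (Suc (\<phi> k)))) \<longlonglongrightarrow> 0"
  proof (rule Lim_null_comparison)
    show "\<forall>\<^sub>F k in sequentially. norm (grad f (x (Suc (\<phi> k)))) \<le> 2 * L * (norm (x (Suc (\<phi> k)) - x (\<phi> k)))\<^sup>2"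
      using grad_next by simp
    have "(\<lambda>k. 2 * L * (norm (x (Suc (\<phi> k)) - x (\<phi> k)))\<^sup>2) \<longlonglongrightarrow> 2 * L * 0\<^sup>2"
      using sub by (intro tendsto_intros)
    then show "(\<lambda>k. 2 * L * (norm (x (Suc (\<phi> k)) - x (\<phi> k)))\<^sup>2) \<longlonglongrightarrow> 0" by simp
  qed
  moreover have "(\<lambda>k. grad f (x (Suc (\<phi> k)))) \<longlonglongrightarrow> grad f l"
    by (rule isCont_tendsto_compose[OF isCont_grad[OF smooth] next_l])
  ultimately have "grad f l = 0" using LIMSEQ_unique by blast
  moreover have "0 \<le> v \<bullet> (hess f l *v v)" for v :: "real^'n"
  proof -
    \<comment> \<open>A fixed \<open>t\<close> eventually exceeds the step length; only afterwards does \<open>t\<close> tend to zero.\<close>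
    have low: "- (14 * L / 3 * (norm v)\<^sup>2) * t \<le> v \<bullet> (hess f l *v v)" if t: "t > 0" for t
    proof (rule tendsto_lowerbound)
      show "(\<lambda>k. v \<bullet> (hess f (x (\<phi> k)) *v v)) \<longlonglongrightarrow> v \<bullet> (hess f l *v v)"
        by (intro tendsto_intros tendsto_matrix_vector_mult
            isCont_tendsto_compose[OF isCont_hess[OF smooth] l'])
      have "\<forall>\<^sub>F k in sequentially. norm (x (Suc (\<phi> k)) - x (\<phi> k)) < t"
        using sub t by (rule order_tendstoD)
      then show "\<forall>\<^sub>F k in sequentially. - (14 * L / 3 * (norm v)\<^sup>2) * t \<le> v \<bullet> (hess f (x (\<phi> k)) *v v)"
      proof eventually_elim
        case (elim k)
        have "- (7 * \<sigma> (\<phi> k) / 3 * t * (norm v)\<^sup>2) \<le> v \<bullet> (hess f (x (\<phi> k)) *v v)"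
          using elim t \<sigma>_pos by (intro cubic_minimizer_curvature[OF _ minimizer]) (auto intro: less_imp_le)
        moreover have "7 * \<sigma> (\<phi> k) / 3 * (t * (norm v)\<^sup>2) \<le> 14 * L / 3 * (t * (norm v)\<^sup>2)"
          using \<sigma>(2)[of "\<phi> k"] t by (intro mult_right_mono) auto
        ultimately show ?case by (simp add: mult.assoc mult.commute[of t])
      qed
    qed simp
    have "((\<lambda>t. - (14 * L / 3 * (norm v)\<^sup>2) * t) \<longlongrightarrow> - (14 * L / 3 * (norm v)\<^sup>2) * 0) (at_right 0)"
      by (intro tendsto_intros)
    moreover have "\<forall>\<^sub>F t in at_right 0. - (14 * L / 3 * (norm v)\<^sup>2) * t \<le> v \<bullet> (hess f l *v v)"
      using low by (auto simp: eventually_at_filter)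
    ultimately have "- (14 * L / 3 * (norm v)\<^sup>2) * 0 \<le> v \<bullet> (hess f l *v v)"
      by (rule tendsto_upperbound) simp
    then show ?thesis by simp
  qed
  ultimately show ?thesis by (simp add: second_order_points_def psd_def)
qed

lemma compact_sublevel:
  assumes "bounded (sublevel f c)"
  shows "compact (sublevel f c)"
  using assms closed_Collect_le[OF continuous_f continuous_on_const]
  by (simp add: compact_eq_bounded_closed sublevel_def)

text \<open>The iterates eventually stay in a compact set, so every subsequence has a limit point, and that is
  a second-order point. This excludes a subsequence at positive distance from those points. It also
  shows that such points exist; for an empty set, \<^const>\<open>infdist\<close> would be constantly zero and
  convergence to zero would say nothing.\<close>

lemma infdist_tendsto_0:
  assumes steps: "(\<lambda>k. norm (x (Suc k) - x k)) \<longlonglongrightarrow> 0"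
    and bdd: "bounded (sublevel f (f (x m)))"
  shows "second_order_points f \<noteq> {}"
    and "(\<lambda>k. infdist (x k) (second_order_points f)) \<longlonglongrightarrow> 0"
proof -
  let ?X = "second_order_points f"
  have lim: "\<exists>l\<in>?X. \<exists>\<psi>. strict_mono \<psi> \<and> (x \<circ> \<phi> \<circ> \<psi>) \<longlonglongrightarrow> l"
    if \<phi>: "strict_mono \<phi>" for \<phi> :: "nat \<Rightarrow> nat"
  proof -
    define \<phi>' where "\<phi>' n = \<phi> (n + m)" for n
    have \<phi>': "strict_mono \<phi>'" using \<phi> by (auto simp: \<phi>'_def strict_mono_def)
    have "(x \<circ> \<phi>') n \<in> sublevel f (f (x m))" for n
      using seq_suble[OF \<phi>, of "n + m"] by (auto simp: \<phi>'_def intro: sublevel_mono)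
    then obtain l \<psi> where \<psi>: "strict_mono \<psi>" and l: "((x \<circ> \<phi>') \<circ> \<psi>) \<longlonglongrightarrow> l"
      using compact_sublevel[OF bdd] unfolding compact_def by blast
    define \<psi>' where "\<psi>' n = \<psi> n + m" for n
    have \<psi>': "strict_mono \<psi>'" using \<psi> by (auto simp: \<psi>'_def strict_mono_def)
    have l': "(x \<circ> \<phi> \<circ> \<psi>') \<longlonglongrightarrow> l" using l by (simp add: o_def \<phi>'_def \<psi>'_def)
    have "l \<in> ?X"
      using limit_point_second_order[OF steps strict_mono_o[OF \<phi> \<psi>']] l' by (simp add: o_assoc)
    with \<psi>' l' show ?thesis by blast
  qed
  show "?X \<noteq> {}" using lim[OF strict_mono_id] by blast
  show "(\<lambda>k. infdist (x k) ?X) \<longlonglongrightarrow> 0"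
  proof (rule ccontr)
    assume "\<not> ?thesis"
    then obtain e where e: "e > 0" and "\<not> (\<forall>\<^sub>F k in sequentially. dist (infdist (x k) ?X) 0 < e)"
      by (auto simp: tendsto_iff)
    then obtain \<phi> :: "nat \<Rightarrow> nat" where \<phi>: "strict_mono \<phi>" and far: "\<And>n. \<not> dist (infdist (x (\<phi> n)) ?X) 0 < e"
      using not_eventually_sequentiallyD[of "\<lambda>k. dist (infdist (x k) ?X) 0 < e"] by blast
    obtain l \<psi> where l: "l \<in> ?X" and "(x \<circ> \<phi> \<circ> \<psi>) \<longlonglongrightarrow> l"
      using lim[OF \<phi>] by blast
    then have "(\<lambda>n. infdist ((x \<circ> \<phi> \<circ> \<psi>) n) ?X) \<longlonglongrightarrow> infdist l ?X"
      by (intro tendsto_infdist)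
    moreover have "e \<le> infdist ((x \<circ> \<phi> \<circ> \<psi>) n) ?X" for n
      using far[of "\<psi> n"] infdist_nonneg[of "x (\<phi> (\<psi> n))" ?X] by (simp add: not_less)
    ultimately have "e \<le> infdist l ?X"
      by (intro LIMSEQ_le_const) auto
    with e l show False by simp
  qed
qed

text \<open>The bound of the step by the distance to a second-order point \<open>z\<close> needs \<open>z \<in> F\<close>. The nearest
  such point does lie in \<open>F\<close> eventually: the iterates stay in a compact subset of the interior of
  \<open>F\<close>, hence at a uniform distance from its boundary.\<close>

lemma step_le_infdist:
  assumes bdd: "bounded (sublevel f (f (x m)))"
    and X: "second_order_points f \<noteq> {}"
    and lim: "(\<lambda>k. infdist (x k) (second_order_points f)) \<longlonglongrightarrow> 0"
  shows "\<forall>\<^sub>F k in sequentially.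
    norm (x (Suc k) - x k) \<le> (1 + 24 * L / \<sigma>bar) * infdist (x k) (second_order_points f)"
proof -
  let ?X = "second_order_points f"
  have "sublevel f (f (x m)) \<subseteq> interior F"
    using F(2) sublevel_mono[of 0 m] by (auto simp: sublevel_def)
  then obtain \<delta> where \<delta>: "\<delta> > 0"
    and nbhd: "(\<Union>y\<in>sublevel f (f (x m)). ball y \<delta>) \<subseteq> interior F"
    using compact_subset_open_imp_ball_epsilon_subset[OF compact_sublevel[OF bdd] open_interior] by blast
  have "\<forall>\<^sub>F k in sequentially. infdist (x k) ?X < \<delta>"
    using lim \<delta> by (rule order_tendstoD)
  with eventually_ge_at_top[of m] show ?thesis
  proof eventually_elim
    case (elim k)
    obtain z where z: "z \<in> ?X" "infdist (x k) ?X = dist (x k) z"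
      using infdist_attains_inf[OF closed_second_order_points[OF smooth] X] by blast
    have "z \<in> ball (x k) \<delta>" using z elim by simp
    with nbhd sublevel_mono[OF elim(1)] have "z \<in> interior F" by blast
    then have "z \<in> F" using interior_subset by blast
    with step_le_dist[OF z(1)] z(2) show ?case by (simp add: dist_norm)
  qed
qed

text \<open>The error bound closes the loop: the distance of the new iterate to the second-order points is at
  most a multiple of its gradient, hence of the squared step, hence of the squared distance of the
  old iterate.\<close>

lemma quadratic_convergence:
  assumes below: "\<And>y. B \<le> f y"
    and bdd: "bounded (sublevel f (f (x m)))"
    and \<kappa>: "0 < \<kappa>" and \<rho>: "0 < \<rho>"
    and error_bound: "\<And>y. infdist y (second_order_points f) \<le> \<rho> \<Longrightarrow>
      infdist y (second_order_points f) \<le> \<kappa> * norm (grad f y)"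
  shows "\<exists>l\<in>second_order_points f. converges_Q_quadratically x l"
proof -
  let ?X = "second_order_points f"
  define c where "c = 1 + 24 * L / \<sigma>bar"
  have c: "c > 0" using L \<sigma>bar by (simp add: c_def add_pos_nonneg)
  note X = infdist_tendsto_0[OF steps_tendsto_0[OF below] bdd]
  have step: "\<forall>\<^sub>F k in sequentially. norm (x (Suc k) - x k) \<le> c * infdist (x k) ?X"
    unfolding c_def by (rule step_le_infdist[OF bdd X])
  have "(\<lambda>k. infdist (x (Suc k)) ?X) \<longlonglongrightarrow> 0"
    using X(2) by (rule LIMSEQ_Suc)
  then have "\<forall>\<^sub>F k in sequentially. infdist (x (Suc k)) ?X < \<rho>"
    using \<rho> by (rule order_tendstoD)
  with step have quad: "\<forall>\<^sub>F k in sequentially.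
      infdist (x (Suc k)) ?X \<le> (2 * \<kappa> * L * c\<^sup>2) * (infdist (x k) ?X)\<^sup>2"
  proof eventually_elim
    case (elim k)
    have "infdist (x (Suc k)) ?X \<le> \<kappa> * norm (grad f (x (Suc k)))"
      using error_bound elim by simp
    also have "\<dots> \<le> \<kappa> * (2 * L * (c * infdist (x k) ?X)\<^sup>2)"
    proof -
      have "2 * L * (norm (x (Suc k) - x k))\<^sup>2 \<le> 2 * L * (c * infdist (x k) ?X)\<^sup>2"
        using elim L by (intro mult_left_mono power_mono) auto
      with grad_next[of k] \<kappa> show ?thesis by (intro mult_left_mono) auto
    qed
    finally show ?case by (simp add: power_mult_distrib algebra_simps)
  qed
  show ?thesis
    using closed_second_order_points[OF smooth] X c _ step quad
    by (rule converges_Q_quadratically_via_infdist) (use \<kappa> L c in simp)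
qed

end

section \<open>Quadratic convergence under the error bound\<close>

theorem theorem2:
  fixes f :: "real^'n \<Rightarrow> real"
    and x0 :: "real^'n"
    and F :: "(real^'n) set"
    and L \<kappa> \<rho> \<sigma>bar :: real
    and x :: "nat \<Rightarrow> real^'n"
  assumes "twice_cont_diff f"
    and "{z. \<forall>y. f z \<le> f y} \<noteq> {}"
    and "closed F" and "convex F"
    and "sublevel f (f x0) \<subseteq> interior F"
    and "L > 0"
    and "\<forall>y\<in>F. \<forall>z\<in>F. onorm ((*v) (hess f y - hess f z)) \<le> L * norm (y - z)"
    and "\<kappa> > 0" and "\<rho> > 0"
    and "\<forall>y. infdist y (second_order_points f) \<le> \<rho> \<longrightarrow>
             infdist y (second_order_points f) \<le> \<kappa> * norm (grad f y)"
    and "\<sigma>bar \<in> {0<..L}"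
    and "cr_iterates f L \<sigma>bar x0 x"
    and "\<exists>k. bounded (sublevel f (f (x k)))"
  shows "\<exists>xstar\<in>second_order_points f. converges_Q_quadratically x xstar"
proof -
  from assms(12) obtain \<sigma> where x0: "x 0 = x0"
    and \<sigma>: "\<And>k. \<sigma> k \<in> {\<sigma>bar..2 * L}"
    and "\<And>k. is_arg_min (cubic_model f (\<sigma> k) (x k)) (\<lambda>_. True) (x (Suc k))"
    and acc: "\<And>k. f (x (Suc k)) \<le> cubic_model_min f (\<sigma> k) (x k)"
    unfolding cr_iterates_def by blast
  then have min: "cubic_model f (\<sigma> k) (x k) (x (Suc k)) \<le> cubic_model f (\<sigma> k) (x k) p" for k p
    by (simp add: is_arg_min_linorder)
  have model: "cubic_model f (\<sigma> k) (x k) p = f (x k) + cubic (grad f (x k)) (hess f (x k)) (\<sigma> k) (p - x k)" for k p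
    by (simp add: cubic_model_def cubic_def)
  interpret cubic_regularization_run f F L \<sigma>bar \<sigma> x
  proof
    fix k h
    show "cubic (grad f (x k)) (hess f (x k)) (\<sigma> k) (x (Suc k) - x k)
        \<le> cubic (grad f (x k)) (hess f (x k)) (\<sigma> k) h"
      using min[of k "x k + h"] by (simp add: model)
    have "bdd_below (range (cubic_model f (\<sigma> k) (x k)))"
      using min[of k] by (intro bdd_belowI) auto
    then have "cubic_model_min f (\<sigma> k) (x k) \<le> cubic_model f (\<sigma> k) (x k) (x (Suc k))"
      unfolding cubic_model_min_def by (intro cINF_lower) auto
    with acc[of k] show "f (x (Suc k)) \<le>
        f (x k) + cubic (grad f (x k)) (hess f (x k)) (\<sigma> k) (x (Suc k) - x k)"
      by (simp add: model)
  qed (use assms \<sigma> x0 in auto)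
  obtain z where "\<And>y. f z \<le> f y" using assms(2) by blast
  moreover obtain m where "bounded (sublevel f (f (x m)))" using assms(13) by blast
  ultimately show ?thesis
    using assms(8-10) quadratic_convergence[of "f z" m \<kappa> \<rho>] by blast
qed

end
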